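(* Let $S$ be a dense subsemigroup of $((0,\infty),+)$ and let $B\subseteq S$. Then $B$ is central near zero if and only if there exist a dynamical system $(X,\langle T_s\rangle_{s\in S})$, points $x,y\in X$ and a neighbourhood $U$ of $y$ such that $x$ and $y$ are proximal near zero, $y$ is uniformly recurrent near zero, and $B=\{s\in S: T_s(x)\in U\}$.
   Context: "Dense" means dense in the usual topology of $(0,\infty)$. $\beta S$ is the Stone–Čech compactification of the discrete set $S$ (ultrafilters on $S$), with $+$ extended so that $(\beta S,+)$ is a compact right topological semigroup: $A\in p+q$ iff $\{x\in S:-x+A\in q\}\in p$, where $-x+A=\{y\in S:x+y\in A\}$. $O^{+}(S)=\{p\in\beta S: S\cap(0,\epsilon)\in p\text{ for every }\epsilon>0\}$, a compact right topological subsemigroup of $\beta S$; $K(O^{+}(S))$ is its smallest two-sided ideal. A set $B\subseteq S$ is central near zero iff there is an idempotent $p\in K(O^{+}(S))$ with $B\in p$. A dynamical system $(X,\langle T_s\rangle_{s\in S})$ consists of a compact Hausdorff space $X$ and continuous maps $T_s:X\to X$ with $T_s\circ T_t=T_{s+t}$. A subset $B\subseteq S$ is syndetic near zero iff for every $\epsilon>0$ there exist a finite nonempty $F\subseteq (0,\epsilon)\cap S$ and $\delta>0$ with $S\cap(0,\delta)\subseteq\bigcup_{t\in F}(-t+B)$. A point $y$ is uniformly recurrent near zero iff for each neighbourhood $W$ of $y$, $\{s\in S:T_s(y)\in W\}$ is syndetic near zero. Points $x,y$ are proximal near zero iff for every neighbourhood $U$ of the diagonal in $X\times X$ and every $\epsilon>0$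 there is $s\in S\cap(0,\epsilon)$ with $(T_s(x),T_s(y))\in U$. *)

theory Defs
  imports "HOL-Analysis.Analysis"
begin

definition ultrafilter_on :: "real set \<Rightarrow> real set set \<Rightarrow> bool" where
  "ultrafilter_on S p \<longleftrightarrow>
     p \<subseteq> Pow S \<and> S \<in> p \<and> {} \<notin> p \<and>
     (\<forall>A B. A \<in> p \<and> B \<in> p \<longrightarrow> A \<inter> B \<in> p) \<and>
     (\<forall>A B. A \<in> p \<and> A \<subseteq> B \<and> B \<subseteq> S \<longrightarrow> B \<in> p) \<and>
     (\<forall>A. A \<subseteq> S \<longrightarrow> A \<in> p \<or> S - A \<in> p)"

definition lshift :: "real set \<Rightarrow> real \<Rightarrow> real set \<Rightarrow> real set" where
  "lshift S x A = {y \<in> S. x + y \<in> A}"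

definition usum :: "real set \<Rightarrow> real set set \<Rightarrow> real set set \<Rightarrow> real set set" where
  "usum S p q = {A. A \<subseteq> S \<and> {x \<in> S. lshift S x A \<in> q} \<in> p}"

definition Oplus :: "real set \<Rightarrow> real set set set" where
  "Oplus S = {p. ultrafilter_on S p \<and> (\<forall>\<epsilon>>0. S \<inter> {0<..<\<epsilon>} \<in> p)}"

definition two_sided_ideal :: "real set \<Rightarrow> real set set set \<Rightarrow> bool" where
  "two_sided_ideal S I \<longleftrightarrow> I \<noteq> {} \<and> I \<subseteq> Oplus S \<and>
     (\<forall>p \<in> Oplus S. \<forall>q \<in> I. usum S p q \<in> I \<and> usum S q p \<in> I)"

definition Kmin :: "real set \<Rightarrow> real set set set" where
  "Kmin S = \<Inter> {I. two_sided_ideal S I}"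

definition central_near_zero :: "real set \<Rightarrow> real set \<Rightarrow> bool" where
  "central_near_zero S B \<longleftrightarrow> (\<exists>p \<in> Kmin S. usum S p p = p \<and> B \<in> p)"

definition syndetic_near_zero :: "real set \<Rightarrow> real set \<Rightarrow> bool" where
  "syndetic_near_zero S B \<longleftrightarrow>
     (\<forall>\<epsilon>>0. \<exists>F. finite F \<and> F \<noteq> {} \<and> F \<subseteq> {0<..<\<epsilon>} \<inter> S \<and>
        (\<exists>\<delta>>0. S \<inter> {0<..<\<delta>} \<subseteq> (\<Union>t\<in>F. lshift S t B)))"

definition nbhd_of :: "'a topology \<Rightarrow> 'a set \<Rightarrow> 'a set \<Rightarrow> bool" where
  "nbhd_of X A U \<longleftrightarrow> (\<exists>V. openin X V \<and> A \<subseteq> V \<and> V \<subseteq> U)"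

definition dynamical_system :: "real set \<Rightarrow> 'a topology \<Rightarrow> (real \<Rightarrow> 'a \<Rightarrow> 'a) \<Rightarrow> bool" where
  "dynamical_system S X T \<longleftrightarrow> compact_space X \<and> Hausdorff_space X \<and>
     (\<forall>s \<in> S. continuous_map X X (T s)) \<and>
     (\<forall>s \<in> S. \<forall>t \<in> S. \<forall>z \<in> topspace X. T s (T t z) = T (s + t) z)"

definition unif_recurrent_near_zero :: "real set \<Rightarrow> 'a topology \<Rightarrow> (real \<Rightarrow> 'a \<Rightarrow> 'a) \<Rightarrow> 'a \<Rightarrow> bool" where
  "unif_recurrent_near_zero S X T y \<longleftrightarrow>
     (\<forall>W. nbhd_of X {y} W \<longrightarrow> syndetic_near_zero S {s \<in> S. T s y \<in> W})"

definition proximal_near_zero :: "real set \<Rightarrow> 'a topology \<Rightarrow> (real \<Rightarrow> 'a \<Rightarrow> 'a) \<Rightarrow> 'a \<Rightarrow> 'a \<Rightarrow> bool" where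
  "proximal_near_zero S X T x y \<longleftrightarrow>
     (\<forall>U. nbhd_of (prod_topology X X) {(z, z) | z. z \<in> topspace X} U \<longrightarrow>
        (\<forall>\<epsilon>>0. \<exists>s \<in> S \<inter> {0<..<\<epsilon>}. (T s x, T s y) \<in> U))"

definition central_witness :: "real set \<Rightarrow> real set \<Rightarrow> 'a topology \<Rightarrow> (real \<Rightarrow> 'a \<Rightarrow> 'a) \<Rightarrow> 'a \<Rightarrow> 'a \<Rightarrow> 'a set \<Rightarrow> bool" where
  "central_witness S B X T x y U \<longleftrightarrow>
     dynamical_system S X T \<and> x \<in> topspace X \<and> y \<in> topspace X \<and> nbhd_of X {y} U \<and>
     proximal_near_zero S X T x y \<and> unif_recurrent_near_zero S X T y \<and>
     B = {s \<in> S. T s x \<in> U}"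

definition dense_subsemigroup :: "real set \<Rightarrow> bool" where
  "dense_subsemigroup S \<longleftrightarrow> S \<subseteq> {0<..} \<and> (\<forall>a \<in> S. \<forall>b \<in> S. a + b \<in> S) \<and>
     {0<..} \<subseteq> closure S"

end

theory Submission
  imports Defs
begin

text \<open>
  If \<open>p\<close> is a minimal idempotent containing \<open>B\<close>, then minimality makes the sets
  \<open>{s. -s + A \<in> p}\<close> with \<open>A \<in> p\<close> syndetic near zero, so \<open>p\<close> is uniformly recurrent under
  translation; idempotence makes it proximal to the point 0.

  Conversely, given \<open>x\<close>, \<open>y\<close> and \<open>U\<close>, the ultrafilters \<open>p\<close> along which \<open>T\<^sub>s x\<close> and \<open>T\<^sub>s y\<close> approach
  each other form a closed left ideal of \<open>O\<^sup>+(S)\<close>, nonempty by proximality. Inside a minimal closed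
  left ideal contained in it, the ultrafilters along which \<open>T\<^sub>s y\<close> returns to \<open>y\<close> form a closed
  subsemigroup, nonempty by uniform recurrence. By Ellis' lemma it contains an idempotent \<open>e\<close>;
  along \<open>e\<close> also \<open>T\<^sub>s x\<close> tends to \<open>y\<close>, so \<open>B \<in> e\<close>. Both closed sets are described directly by
  membership of return-time sets in the ultrafilter, so no limits along ultrafilters are needed.
\<close>

subsection \<open>Compact right topological semigroups\<close>

locale compact_right_topological_semigroup =
  fixes X :: "'a topology" and mult :: "'a \<Rightarrow> 'a \<Rightarrow> 'a" (infixl "\<cdot>" 70)
  assumes compact: "compact_space X"
    and Hausdorff: "Hausdorff_space X"
    and mult_closed: "a \<in> topspace X \<Longrightarrow> b \<in> topspace X \<Longrightarrow> a \<cdot> b \<in> topspace X"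
    and mult_assoc: "a \<in> topspace X \<Longrightarrow> b \<in> topspace X \<Longrightarrow> c \<in> topspace X \<Longrightarrow> a \<cdot> b \<cdot> c = a \<cdot> (b \<cdot> c)"
    and continuous_mult_right: "b \<in> topspace X \<Longrightarrow> continuous_map X X (\<lambda>a. a \<cdot> b)"
begin

text \<open>Here and in \<open>subsemigroup\<close>, nonemptiness stays outside the predicate, so
  that arbitrary intersections preserve it, as \<open>minimal_closed_subset\<close> demands.\<close>

definition left_ideal :: "'a set \<Rightarrow> bool" where
  "left_ideal L \<longleftrightarrow> (\<forall>a \<in> topspace X. \<forall>b \<in> L. a \<cdot> b \<in> L)"

definition subsemigroup :: "'a set \<Rightarrow> bool" where
  "subsemigroup A \<longleftrightarrow> (\<forall>a \<in> A. \<forall>b \<in> A. a \<cdot> b \<in> A)"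

lemma closedin_image_mult_right:
  "closedin X C \<Longrightarrow> b \<in> topspace X \<Longrightarrow> closedin X ((\<lambda>a. a \<cdot> b) ` C)"
  using continuous_imp_closed_map[OF continuous_mult_right compact Hausdorff]
  by (auto simp: closed_map_def)

text \<open>By compactness a chain of nonempty closed sets has nonempty intersection, so Zorn's
  lemma applies. The property \<open>Q\<close> is kept abstract to serve both left ideals and
  subsemigroups.\<close>

lemma minimal_closed_subset:
  assumes "closedin X C" "C \<noteq> {}" "Q C"
    and Q_Inter: "\<And>\<C>. \<C> \<noteq> {} \<Longrightarrow> (\<And>D. D \<in> \<C> \<Longrightarrow> Q D) \<Longrightarrow> Q (\<Inter>\<C>)"
  obtains M where "closedin X M" "M \<noteq> {}" "Q M" "M \<subseteq> C"
    "\<And>D. closedin X D \<Longrightarrow> D \<noteq> {} \<Longrightarrow> Q D \<Longrightarrow> D \<subseteq> M \<Longrightarrow> D = M"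
proof -
  define \<D> where "\<D> = {D. closedin X D \<and> D \<noteq> {} \<and> Q D \<and> D \<subseteq> C}"
  \<comment> \<open>Zorn's lemma is used in its maximal form, hence the passage to complements,
    which turns unions of chains into intersections.\<close>
  have "\<exists>M \<in> uminus ` \<D>. \<forall>N \<in> uminus ` \<D>. M \<subseteq> N \<longrightarrow> N = M"
  proof (rule subset_Zorn_nonempty)
    show "uminus ` \<D> \<noteq> {}"
      using assms by (auto simp: \<D>_def)
  next
    fix \<N> :: "'a set set"
    assume "\<N> \<noteq> {}" and chain: "subset.chain (uminus ` \<D>) \<N>"
    define \<C> where "\<C> = uminus ` \<N>"
    have C: "\<C> \<noteq> {}" "\<C> \<subseteq> \<D>"
      using \<open>\<N> \<noteq> {}\<close> chain by (auto simp: \<C>_def subset_chain_def)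
    have chain': "subset.chain \<D> \<C>"
      using chain C by (auto simp: \<C>_def subset_chain_def)
    have ne: "\<Inter>\<C> \<noteq> {}"
    proof -
      have fip: "\<Inter>\<F> \<noteq> {}" if "finite \<F>" "\<F> \<subseteq> \<C>" for \<F>
      proof (cases "\<F> = {}")
        case False
        then have "\<Inter>\<F> \<in> \<F>"
          using that chain' by (intro Inter_in_chain[of \<F> \<D>]) (auto simp: subset_chain_def, blast)
        with that C show ?thesis by (auto simp: \<D>_def)
      qed simp
      have "closedin X D" if "D \<in> \<C>" for D
        using C that by (auto simp: \<D>_def)
      with fip show ?thesis
        by (intro compact_space_fip[THEN iffD1, rule_format, OF compact]) auto
    qed
    have "\<Inter>\<C> \<in> \<D>"
      unfolding \<D>_def mem_Collect_eq
    proof (intro conjI ne)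
      show "closedin X (\<Inter>\<C>)" "Q (\<Inter>\<C>)" "\<Inter>\<C> \<subseteq> C"
        using C by (auto simp: \<D>_def intro!: closedin_Inter Q_Inter)
    qed
    moreover have "\<Union>\<N> = - \<Inter>\<C>"
      by (auto simp: \<C>_def)
    ultimately show "\<Union>\<N> \<in> uminus ` \<D>" by blast
  qed
  then obtain M where M: "M \<in> \<D>" "\<And>N. N \<in> \<D> \<Longrightarrow> N \<subseteq> M \<Longrightarrow> N = M"
    by auto
  show thesis
    by (rule that[of M]) (use M in \<open>auto simp: \<D>_def\<close>)
qed

text \<open>A minimal closed left ideal \<open>L\<close> equals \<open>X \<cdot> (q \<cdot> z)\<close> for all \<open>z \<in> L\<close> and all \<open>q\<close>,
  because the latter is a closed left ideal contained in \<open>L\<close>.\<close>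

lemma closed_left_ideal_contains_minimal:
  assumes "closedin X C" "C \<noteq> {}" "left_ideal C"
  obtains L where "closedin X L" "L \<noteq> {}" "left_ideal L" "L \<subseteq> C"
    "\<forall>z \<in> L. \<forall>q \<in> topspace X. \<exists>r \<in> topspace X. z = r \<cdot> (q \<cdot> z)"
proof -
  obtain L where L: "closedin X L" "L \<noteq> {}" "left_ideal L" "L \<subseteq> C"
    and min: "\<And>D. closedin X D \<Longrightarrow> D \<noteq> {} \<Longrightarrow> left_ideal D \<Longrightarrow> D \<subseteq> L \<Longrightarrow> D = L"
    by (rule minimal_closed_subset[where Q = left_ideal, OF assms]) (auto simp: left_ideal_def)
  have r: "\<exists>r \<in> topspace X. z = r \<cdot> (q \<cdot> z)" if z: "z \<in> L" and q: "q \<in> topspace X" for z q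
  proof -
    let ?D = "(\<lambda>r. r \<cdot> (q \<cdot> z)) ` topspace X"
    have qz: "q \<cdot> z \<in> L" "q \<cdot> z \<in> topspace X"
      using L z q closedin_subset[OF L(1)] by (auto simp: left_ideal_def)
    have "?D = L"
    proof (rule min)
      show "closedin X ?D"
        using closedin_image_mult_right[OF closedin_topspace] qz by blast
      show "?D \<noteq> {}" using q by auto
      show "left_ideal ?D"
        unfolding left_ideal_def
        using qz by (auto simp: mult_assoc[symmetric] intro!: imageI mult_closed)
      show "?D \<subseteq> L"
        using L(3) qz by (auto simp: left_ideal_def)
    qed
    with z show ?thesis by auto
  qed
  show thesis by (rule that[OF L]) (intro ballI r)
qed

text \<open>Ellis' lemma. For \<open>e\<close> in a minimal closed subsemigroup \<open>A\<close>,
  minimality gives first \<open>A \<cdot> e = A\<close>, so that some \<open>a\<close> satisfies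
  \<open>a \<cdot> e = e\<close>, and then that every \<open>a\<close> in \<open>A\<close> does, in
  particular \<open>e\<close> itself.\<close>

lemma closed_subsemigroup_contains_idempotent:
  assumes "closedin X C" "C \<noteq> {}" "subsemigroup C"
  obtains e where "e \<in> C" "e \<cdot> e = e"
proof -
  obtain A where A: "closedin X A" "A \<noteq> {}" "subsemigroup A" "A \<subseteq> C"
    and min: "\<And>D. closedin X D \<Longrightarrow> D \<noteq> {} \<Longrightarrow> subsemigroup D \<Longrightarrow> D \<subseteq> A \<Longrightarrow> D = A"
    by (rule minimal_closed_subset[where Q = subsemigroup, OF assms]) (auto simp: subsemigroup_def)
  obtain e where e: "e \<in> A" using A by blast
  have sub: "A \<subseteq> topspace X" using A(1) by (rule closedin_subset)
  have mA: "a \<cdot> b \<in> A" if "a \<in> A" "b \<in> A" for a b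
    using A(3) that by (auto simp: subsemigroup_def)
  have eX: "e \<in> topspace X" using e sub by blast
  have "(\<lambda>a. a \<cdot> e) ` A = A"
  proof (rule min)
    show "closedin X ((\<lambda>a. a \<cdot> e) ` A)"
      using closedin_image_mult_right A(1) eX by blast
    show "subsemigroup ((\<lambda>a. a \<cdot> e) ` A)"
      unfolding subsemigroup_def
    proof clarify
      fix a b assume "a \<in> A" "b \<in> A"
      moreover have "a \<cdot> e \<cdot> (b \<cdot> e) = a \<cdot> e \<cdot> b \<cdot> e"
        using \<open>a \<in> A\<close> \<open>b \<in> A\<close> e sub mA by (subst mult_assoc[of "a \<cdot> e" b e]) auto
      ultimately show "a \<cdot> e \<cdot> (b \<cdot> e) \<in> (\<lambda>a. a \<cdot> e) ` A"
        using e mA by auto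
    qed
  qed (use e mA in auto)
  then obtain a where a: "a \<in> A" "a \<cdot> e = e" using e by (metis imageE)
  have "{a \<in> A. a \<cdot> e = e} = A"
  proof (rule min)
    have "{a \<in> A. a \<cdot> e = e} = {a \<in> A. a \<cdot> e \<in> {e}}" by simp
    also have "closedin X \<dots>"
      using continuous_mult_right[OF eX] A(1) eX Hausdorff
      by (intro closedin_continuous_map_preimage_gen closedin_Hausdorff_singleton)
    finally show "closedin X {a \<in> A. a \<cdot> e = e}" .
    show "subsemigroup {a \<in> A. a \<cdot> e = e}"
      unfolding subsemigroup_def using mA sub eX by (auto simp: mult_assoc subset_iff)
  qed (use a in auto)
  with e A(4) that show thesis by blast
qed

end

subsection \<open>The topology of pointwise convergence on sets\<close>

text \<open>A set is identified with its indicator function, so this is a product of two-point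
  discrete spaces. On the ultrafilters on \<open>S\<close> it induces the Stone topology of beta S,
  whose compactness thus comes from Tychonoff's theorem.\<close>

definition pointwise_topology :: "'a set topology" where
  "pointwise_topology =
     pullback_topology UNIV (\<lambda>p a. a \<in> p) (product_topology (\<lambda>_. discrete_topology (UNIV :: bool set)) UNIV)"

lemma topspace_pointwise_topology [simp]: "topspace pointwise_topology = UNIV"
  by (simp add: pointwise_topology_def topspace_pullback_topology)

lemma homeomorphic_map_pointwise_topology:
  "homeomorphic_map pointwise_topology (product_topology (\<lambda>_. discrete_topology (UNIV :: bool set)) UNIV) (\<lambda>p a. a \<in> p)"
proof -
  have "homeomorphic_maps pointwise_topology (product_topology (\<lambda>_. discrete_topology (UNIV :: bool set)) UNIV)
          (\<lambda>p a. a \<in> p) Collect"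
    unfolding homeomorphic_maps_def
  proof (intro conjI)
    show "continuous_map pointwise_topology (product_topology (\<lambda>_. discrete_topology (UNIV :: bool set)) UNIV) (\<lambda>p a. a \<in> p)"
      using continuous_map_pullback[OF continuous_map_id] by (simp add: pointwise_topology_def o_def id_def)
    show "continuous_map (product_topology (\<lambda>_. discrete_topology (UNIV :: bool set)) UNIV) pointwise_topology Collect"
      unfolding pointwise_topology_def
      by (rule continuous_map_pullback') (auto simp: o_def)
  qed auto
  then show ?thesis by (auto simp: homeomorphic_map_maps)
qed

lemma compact_space_pointwise_topology: "compact_space (pointwise_topology :: 'a set topology)"
  and Hausdorff_space_pointwise_topology: "Hausdorff_space (pointwise_topology :: 'a set topology)"
proof -
  have hom: "(pointwise_topology :: 'a set topology) homeomorphic_space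
               product_topology (\<lambda>_. discrete_topology (UNIV :: bool set)) (UNIV :: 'a set)"
    by (rule homeomorphic_map_imp_homeomorphic_space[OF homeomorphic_map_pointwise_topology])
  show "compact_space (pointwise_topology :: 'a set topology)"
    using homeomorphic_compact_space[OF hom]
    by (simp add: compact_space_product_topology compact_space_discrete_topology)
  show "Hausdorff_space (pointwise_topology :: 'a set topology)"
    using homeomorphic_Hausdorff_space[OF hom] by (simp add: Hausdorff_space_product_topology)
qed

lemma openin_pointwise_topology_basis:
  assumes "openin pointwise_topology W" "y \<in> W"
  obtains F where "finite F" "{q. \<forall>a\<in>F. a \<in> q \<longleftrightarrow> a \<in> y} \<subseteq> W"
proof -
  obtain V where V: "openin (product_topology (\<lambda>_. discrete_topology (UNIV :: bool set)) UNIV) V"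
    and W: "W = (\<lambda>p a. a \<in> p) -` V"
    using assms(1) by (auto simp: pointwise_topology_def openin_pullback_topology)
  have "(\<lambda>a. a \<in> y) \<in> V" using assms(2) W by simp
  then obtain U where U: "finite {i. U i \<noteq> UNIV}" "(\<lambda>a. a \<in> y) \<in> Pi\<^sub>E UNIV U" "Pi\<^sub>E UNIV U \<subseteq> V"
    using V unfolding openin_product_topology_alt by fastforce
  show thesis
  proof (rule that[of "{i. U i \<noteq> UNIV}"])
    show "{q. \<forall>a\<in>{i. U i \<noteq> UNIV}. a \<in> q \<longleftrightarrow> a \<in> y} \<subseteq> W"
    proof
      fix q assume q: "q \<in> {q. \<forall>a\<in>{i. U i \<noteq> UNIV}. a \<in> q \<longleftrightarrow> a \<in> y}"
      have "(a \<in> q) \<in> U a" for a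
        using q U(2) by (cases "U a = UNIV") (auto simp: PiE_iff)
      then have "(\<lambda>a. a \<in> q) \<in> V" using U(3) by (auto simp: PiE_iff)
      then show "q \<in> W" by (simp add: W)
    qed
  qed (rule U(1))
qed

lemma continuous_map_into_pointwise_topology:
  "continuous_map Y pointwise_topology f \<longleftrightarrow>
     (\<forall>a. continuous_map Y (discrete_topology UNIV) (\<lambda>y. a \<in> f y))"
proof
  assume "continuous_map Y pointwise_topology f"
  then have "continuous_map Y (product_topology (\<lambda>_. discrete_topology (UNIV :: bool set)) UNIV) (\<lambda>y a. a \<in> f y)"
    using continuous_map_compose homeomorphic_imp_continuous_map[OF homeomorphic_map_pointwise_topology]
    by (fastforce simp: o_def)
  then show "\<forall>a. continuous_map Y (discrete_topology UNIV) (\<lambda>y. a \<in> f y)"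
    by (simp add: continuous_map_componentwise_UNIV)
next
  assume "\<forall>a. continuous_map Y (discrete_topology UNIV) (\<lambda>y. a \<in> f y)"
  then show "continuous_map Y pointwise_topology f"
    unfolding pointwise_topology_def
    by (intro continuous_map_pullback') (auto simp: o_def continuous_map_componentwise_UNIV)
qed

lemma continuous_map_membership:
  "continuous_map pointwise_topology (discrete_topology UNIV) (\<lambda>p. (a :: 'a) \<in> p)"
  using continuous_map_into_pointwise_topology[of "pointwise_topology :: 'a set topology" id] by simp

lemma clopen_membership:
  "closedin pointwise_topology {p. a \<in> p}" "closedin pointwise_topology {p. a \<notin> p}"
  "openin pointwise_topology {p. a \<in> p}"
  using closedin_continuous_map_preimage[OF continuous_map_membership, of "{True}" a]
    closedin_continuous_map_preimage[OF continuous_map_membership, of "{False}" a]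
    openin_continuous_map_preimage[OF continuous_map_membership, of "{True}" a]
  by auto

text \<open>The conditions \<open>a \<in> p\<close> are closed, so this is the finite intersection
  property for \<open>C\<close> together with one such condition for each \<open>a\<close> in
  \<open>G\<close>.\<close>

lemma closed_set_superset_compactness:
  fixes C :: "'a set set"
  assumes C: "closedin pointwise_topology C"
    and fin: "\<And>F. finite F \<Longrightarrow> F \<subseteq> G \<Longrightarrow> \<exists>p\<in>C. F \<subseteq> p"
  obtains p where "p \<in> C" "G \<subseteq> p"
proof -
  define E :: "'a \<Rightarrow> 'a set set" where "E a = {p. a \<in> p}" for a
  define \<U> where "\<U> = insert C (E ` G)"
  have fip: "\<Inter>\<F> \<noteq> {}" if F: "finite \<F>" "\<F> \<subseteq> \<U>" for \<F>
  proof -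
    have "finite (\<F> - {C})" "\<F> - {C} \<subseteq> E ` G"
      using F by (auto simp: \<U>_def)
    then have "\<exists>F\<subseteq>G. finite F \<and> \<F> - {C} = E ` F"
      by (rule finite_subset_image)
    then obtain F where F: "F \<subseteq> G" "finite F" "\<F> - {C} = E ` F"
      by metis
    obtain p where "p \<in> C" "F \<subseteq> p" using fin[OF F(2,1)] by blast
    have "\<F> \<subseteq> insert C (E ` F)"
      unfolding F(3)[symmetric] by blast
    moreover have "p \<in> E a" if "a \<in> F" for a
      using \<open>F \<subseteq> p\<close> that by (auto simp: E_def)
    ultimately have "p \<in> \<Inter>\<F>" using \<open>p \<in> C\<close> by blast
    then show ?thesis by blast
  qed
  have "closedin pointwise_topology D" if "D \<in> \<U>" for D
    using C that by (auto simp: \<U>_def E_def clopen_membership(1))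
  with fip have "\<Inter>\<U> \<noteq> {}"
    by (intro compact_space_fip[THEN iffD1, rule_format, OF compact_space_pointwise_topology]) auto
  then obtain p where p: "p \<in> \<Inter>\<U>" by blast
  show thesis by (rule that[of p]) (use p in \<open>auto simp: \<U>_def E_def\<close>)
qed

subsection \<open>Ultrafilters\<close>

lemma
  assumes "ultrafilter_on S p"
  shows ultrafilter_on_subset: "A \<in> p \<Longrightarrow> A \<subseteq> S"
    and ultrafilter_on_space: "S \<in> p"
    and ultrafilter_on_empty: "{} \<notin> p"
    and ultrafilter_on_Int: "A \<in> p \<Longrightarrow> B \<in> p \<Longrightarrow> A \<inter> B \<in> p"
    and ultrafilter_on_mono: "A \<in> p \<Longrightarrow> A \<subseteq> B \<Longrightarrow> B \<subseteq> S \<Longrightarrow> B \<in> p"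
    and ultrafilter_on_cases: "A \<subseteq> S \<Longrightarrow> A \<in> p \<or> S - A \<in> p"
proof -
  have u: "p \<subseteq> Pow S" "S \<in> p" "{} \<notin> p" "\<forall>A B. A \<in> p \<and> B \<in> p \<longrightarrow> A \<inter> B \<in> p"
    "\<forall>A B. A \<in> p \<and> A \<subseteq> B \<and> B \<subseteq> S \<longrightarrow> B \<in> p" "\<forall>A. A \<subseteq> S \<longrightarrow> A \<in> p \<or> S - A \<in> p"
    using assms unfolding ultrafilter_on_def by - (elim conjE, assumption)+
  show "A \<in> p \<Longrightarrow> A \<subseteq> S" "S \<in> p" "{} \<notin> p" using u(1,2,3) by auto
  show "A \<in> p \<Longrightarrow> B \<in> p \<Longrightarrow> A \<inter> B \<in> p" using u(4) by simp
  show "A \<in> p \<Longrightarrow> A \<subseteq> B \<Longrightarrow> B \<subseteq> S \<Longrightarrow> B \<in> p" using u(5) by meson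
  show "A \<subseteq> S \<Longrightarrow> A \<in> p \<or> S - A \<in> p" using u(6) by simp
qed

lemma ultrafilter_on_Diff_iff:
  assumes "ultrafilter_on S p" "A \<subseteq> S"
  shows "S - A \<in> p \<longleftrightarrow> A \<notin> p"
proof -
  have "\<not> (A \<in> p \<and> S - A \<in> p)"
  proof
    assume "A \<in> p \<and> S - A \<in> p"
    then have "A \<inter> (S - A) \<in> p" by (intro ultrafilter_on_Int[OF assms(1)]) simp_all
    then show False using ultrafilter_on_empty[OF assms(1)] by (simp add: Int_Diff)
  qed
  then show ?thesis using ultrafilter_on_cases[OF assms] by blast
qed

lemma ultrafilter_on_finite_INT:
  assumes "ultrafilter_on S p" "finite F" "\<And>a. a \<in> F \<Longrightarrow> C a \<in> p"
  shows "{s \<in> S. \<forall>a\<in>F. s \<in> C a} \<in> p"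
  using assms(2,3)
proof (induction F rule: finite_induct)
  case empty
  then show ?case using ultrafilter_on_space[OF assms(1)] by simp
next
  case (insert a F)
  then have "C a \<inter> {s \<in> S. \<forall>a\<in>F. s \<in> C a} \<in> p"
    using ultrafilter_on_Int[OF assms(1)] by simp
  then show ?case
    by (rule ultrafilter_on_mono[OF assms(1)]) auto
qed

lemma ultrafilter_on_finite_UN:
  assumes "ultrafilter_on S p" "finite F" "(\<Union>t\<in>F. C t) \<in> p"
  obtains t where "t \<in> F" "C t \<in> p"
proof -
  have sub: "C t \<subseteq> S" if "t \<in> F" for t
    using ultrafilter_on_subset[OF assms(1,3)] that by blast
  have False if "\<forall>t\<in>F. C t \<notin> p"
  proof -
    have "S - C t \<in> p" if "t \<in> F" for t
      using ultrafilter_on_Diff_iff[OF assms(1) sub] that \<open>\<forall>t\<in>F. C t \<notin> p\<close> by blast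
    then have "{s \<in> S. \<forall>t\<in>F. s \<in> S - C t} \<in> p"
      by (rule ultrafilter_on_finite_INT[OF assms(1,2)])
    from ultrafilter_on_Int[OF assms(1) this assms(3)]
    have "{s \<in> S. \<forall>t\<in>F. s \<in> S - C t} \<inter> (\<Union>t\<in>F. C t) \<in> p" .
    moreover have "{s \<in> S. \<forall>t\<in>F. s \<in> S - C t} \<inter> (\<Union>t\<in>F. C t) = {}" by blast
    ultimately show False using ultrafilter_on_empty[OF assms(1)] by simp
  qed
  then show thesis using that by blast
qed

text \<open>Each axiom is a conjunction of clauses that test membership of at most three sets in
  \<open>p\<close>, and each such test is clopen.\<close>

lemma closedin_ultrafilters: "closedin pointwise_topology {p. ultrafilter_on S p}"
proof -
  define I :: "real set \<Rightarrow> real set set set" where "I A = {p. A \<in> p}" for A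
  define N :: "real set \<Rightarrow> real set set set" where "N A = {p. A \<notin> p}" for A
  \<comment> \<open>\<open>K\<close> turns side conditions that do not mention \<open>p\<close>,
    such as \<open>A \<subseteq> S\<close>, into the empty or the full space, so that every clause
    becomes a union of closed sets.\<close>
  define K :: "bool \<Rightarrow> real set set set" where "K c = {p. c}" for c
  have I: "closedin pointwise_topology (I A)" for A
    unfolding I_def by (rule clopen_membership)
  have N: "closedin pointwise_topology (N A)" for A
    unfolding N_def by (rule clopen_membership)
  have K: "closedin pointwise_topology (K c)" for c
    using closedin_topspace[of "pointwise_topology :: real set set topology"] by (cases c) (auto simp: K_def)
  have "{p. ultrafilter_on S p} =
      (\<Inter>A. N A \<union> K (A \<subseteq> S)) \<inter> I S \<inter> N {} \<inter>
      (\<Inter>A. \<Inter>B. N A \<union> N B \<union> I (A \<inter> B)) \<inter>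
      (\<Inter>A. \<Inter>B. N A \<union> K (\<not> (A \<subseteq> B \<and> B \<subseteq> S)) \<union> I B) \<inter>
      (\<Inter>A. K (\<not> A \<subseteq> S) \<union> I A \<union> I (S - A))"
    (is "_ = ?R")
  proof (rule set_eqI)
    fix p
    have "p \<subseteq> Pow S \<longleftrightarrow> (\<forall>A. A \<notin> p \<or> A \<subseteq> S)" by blast
    then show "p \<in> {p. ultrafilter_on S p} \<longleftrightarrow> p \<in> ?R"
      by (simp only: ultrafilter_on_def imp_conv_disj disj_assoc I_def N_def K_def mem_Collect_eq
          Int_iff Un_iff INT_iff UNIV_I de_Morgan_conj conj_assoc simp_thms ball_UNIV)
  qed
  also have "closedin pointwise_topology ?R"
    by (intro closedin_Int closedin_INT closedin_Un I N K UNIV_not_empty)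
  finally show ?thesis .
qed

lemma closedin_Oplus: "closedin pointwise_topology (Oplus S)"
proof -
  have "Oplus S = {p. ultrafilter_on S p} \<inter> (\<Inter>\<epsilon>\<in>{0<..}. {p. S \<inter> {0<..<\<epsilon>} \<in> p})"
    by (auto simp: Oplus_def)
  also have "closedin pointwise_topology \<dots>"
    by (intro closedin_Int closedin_ultrafilters closedin_INT clopen_membership(1)) simp
  finally show ?thesis .
qed

lemma ultrafilter_on_principal: "a \<in> S \<Longrightarrow> ultrafilter_on S {A. A \<subseteq> S \<and> a \<in> A}"
  unfolding ultrafilter_on_def by auto

text \<open>Finite subfamilies are realised by principal ultrafilters; compactness does the rest.\<close>

lemma ultrafilter_on_extends_fip:
  assumes "G \<subseteq> Pow S" "\<And>F. finite F \<Longrightarrow> F \<subseteq> G \<Longrightarrow> S \<inter> \<Inter>F \<noteq> {}"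
  obtains p where "ultrafilter_on S p" "G \<subseteq> p"
proof -
  have "\<exists>p\<in>{p. ultrafilter_on S p}. F \<subseteq> p" if F: "finite F" "F \<subseteq> G" for F
  proof -
    obtain a where "a \<in> S" "a \<in> \<Inter>F" using assms(2)[OF F] by blast
    then show ?thesis
      using ultrafilter_on_principal[of a S] F(2) assms(1)
      by (intro bexI[of _ "{A. A \<subseteq> S \<and> a \<in> A}"]) auto
  qed
  then obtain p where "p \<in> {p. ultrafilter_on S p}" "G \<subseteq> p"
    by (rule closed_set_superset_compactness[OF closedin_ultrafilters])
  then show thesis by (intro that) auto
qed

text \<open>As \<open>G\<close> is closed under binary intersections, finitely many members of
  \<open>G\<close> and initial intervals have an intersection containing some
  \<open>A \<inter> {0<..<\<epsilon>}\<close> with \<open>A \<in> G\<close>, which is nonempty. All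
  ultrafilters near zero below are first obtained this way.\<close>

lemma Oplus_extends_filter_base:
  assumes sub: "\<And>A. A \<in> G \<Longrightarrow> A \<subseteq> S"
    and Int: "\<And>A A'. A \<in> G \<Longrightarrow> A' \<in> G \<Longrightarrow> A \<inter> A' \<in> G" and "G \<noteq> {}"
    and meets: "\<And>A \<epsilon>. A \<in> G \<Longrightarrow> \<epsilon> > 0 \<Longrightarrow> A \<inter> {0<..<\<epsilon>} \<noteq> {}"
  obtains p where "p \<in> Oplus S" "G \<subseteq> p"
proof -
  let ?H = "G \<union> (\<lambda>\<epsilon>. S \<inter> {0<..<\<epsilon>}) ` {0<..}"
  have base: "\<exists>A\<in>G. \<exists>\<epsilon>>0. A \<inter> {0<..<\<epsilon>} \<subseteq> \<Inter>F" if "finite F" "F \<subseteq> ?H" for F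
    using that
  proof (induction F rule: finite_induct)
    case empty
    then show ?case using \<open>G \<noteq> {}\<close> by (auto intro: gt_ex)
  next
    case (insert B F)
    then obtain A \<epsilon> where A: "A \<in> G" "\<epsilon> > 0" "A \<inter> {0<..<\<epsilon>} \<subseteq> \<Inter>F" by auto
    consider "B \<in> G" | \<delta> where "\<delta> > 0" "B = S \<inter> {0<..<\<delta>}"
      using insert.prems by auto
    then show ?case
    proof cases
      case 1
      then have "(A \<inter> B) \<inter> {0<..<\<epsilon>} \<subseteq> \<Inter>(insert B F)" using A(3) by auto
      then show ?thesis using Int[OF A(1) 1] A(2) by blast
    next
      case 2
      have "A \<inter> {0<..<min \<epsilon> \<delta>} \<subseteq> \<Inter>F"
        by (rule subset_trans[OF _ A(3)]) auto
      then have "A \<inter> {0<..<min \<epsilon> \<delta>} \<subseteq> \<Inter>(insert B F)"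
        using sub[OF A(1)] 2 by auto
      moreover have "min \<epsilon> \<delta> > 0" using A(2) 2(1) by simp
      ultimately show ?thesis using A(1) by blast
    qed
  qed
  have "S \<inter> \<Inter>F \<noteq> {}" if F: "finite F" "F \<subseteq> ?H" for F
  proof -
    obtain A \<epsilon> where A: "A \<in> G" "\<epsilon> > 0" "A \<inter> {0<..<\<epsilon>} \<subseteq> \<Inter>F"
      using base[OF F] by blast
    then show ?thesis using meets[OF A(1,2)] sub[OF A(1)] by blast
  qed
  with _ obtain p where "ultrafilter_on S p" "?H \<subseteq> p"
    by (rule ultrafilter_on_extends_fip) (use sub in auto)
  then show thesis
    using that[of p] by (auto simp: Oplus_def)
qed

subsection \<open>The semigroup of ultrafilters near zero\<close>

lemma in_usum_iff: "A \<in> usum S p q \<longleftrightarrow> A \<subseteq> S \<and> {x \<in> S. lshift S x A \<in> q} \<in> p"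
  by (simp add: usum_def)

lemma lshift_subset: "lshift S x A \<subseteq> S"
  by (auto simp: lshift_def)

lemma syndetic_near_zero_mono:
  assumes "syndetic_near_zero S A" "A \<subseteq> B"
  shows "syndetic_near_zero S B"
proof -
  have "(\<Union>t\<in>F. lshift S t A) \<subseteq> (\<Union>t\<in>F. lshift S t B)" for F
    using assms(2) by (auto simp: lshift_def)
  then show ?thesis
    using assms(1) unfolding syndetic_near_zero_def by (meson subset_trans)
qed

context
  fixes S :: "real set"
  assumes S: "dense_subsemigroup S"
begin

lemma add_closed: "a \<in> S \<Longrightarrow> b \<in> S \<Longrightarrow> a + b \<in> S"
  using S by (auto simp: dense_subsemigroup_def)

text \<open>Density of \<open>S\<close> enters the argument through this lemma alone.\<close>

lemma meets_initial_interval: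
  assumes "\<epsilon> > 0"
  shows "S \<inter> {0<..<\<epsilon>} \<noteq> {}"
proof -
  have "\<epsilon> / 2 \<in> closure S"
    using S assms by (auto simp: dense_subsemigroup_def)
  moreover have "open {0<..<\<epsilon>}" "\<epsilon> / 2 \<in> {0<..<\<epsilon>}" using assms by auto
  ultimately show ?thesis
    using open_Int_closure_eq_empty[of "{0<..<\<epsilon>}" S] by blast
qed

lemma lshift_lshift:
  "x \<in> S \<Longrightarrow> y \<in> S \<Longrightarrow> lshift S y (lshift S x A) = lshift S (x + y) A"
  by (auto simp: lshift_def add_closed add.assoc)

lemma lshift_Diff: "x \<in> S \<Longrightarrow> lshift S x (S - A) = S - lshift S x A"
  by (auto simp: lshift_def add_closed)

text \<open>\<open>lshift S x\<close> commutes with the Boolean operations and membership in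
  \<open>q\<close> respects them, so \<open>A \<mapsto> {x \<in> S. lshift S x A \<in> q}\<close>
  carries the axioms back from \<open>p\<close>.\<close>

lemma ultrafilter_on_usum:
  assumes p: "ultrafilter_on S p" and q: "ultrafilter_on S q"
  shows "ultrafilter_on S (usum S p q)"
  unfolding ultrafilter_on_def
proof (intro conjI allI impI)
  have "lshift S x S = S" if "x \<in> S" for x using that by (auto simp: lshift_def add_closed)
  then have "{x \<in> S. lshift S x S \<in> q} = S" using ultrafilter_on_space[OF q] by auto
  then show "S \<in> usum S p q"
    using ultrafilter_on_space[OF p] by (simp add: in_usum_iff)
  have "lshift S x {} = {}" for x by (simp add: lshift_def)
  then show "{} \<notin> usum S p q"
    using ultrafilter_on_empty[OF p] ultrafilter_on_empty[OF q] by (simp add: in_usum_iff)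
  show "usum S p q \<subseteq> Pow S" by (auto simp: in_usum_iff)
next
  fix A B assume AB: "A \<in> usum S p q \<and> B \<in> usum S p q"
  have "{x \<in> S. lshift S x A \<in> q} \<inter> {x \<in> S. lshift S x B \<in> q} \<in> p"
    using AB by (intro ultrafilter_on_Int[OF p]) (simp_all add: in_usum_iff)
  moreover have "{x \<in> S. lshift S x A \<in> q} \<inter> {x \<in> S. lshift S x B \<in> q} \<subseteq> {x \<in> S. lshift S x (A \<inter> B) \<in> q}"
  proof clarify
    fix x assume "lshift S x A \<in> q" "lshift S x B \<in> q"
    then have "lshift S x A \<inter> lshift S x B \<in> q" by (rule ultrafilter_on_Int[OF q])
    moreover have "lshift S x A \<inter> lshift S x B = lshift S x (A \<inter> B)" by (auto simp: lshift_def)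
    ultimately show "lshift S x (A \<inter> B) \<in> q" by simp
  qed
  ultimately have "{x \<in> S. lshift S x (A \<inter> B) \<in> q} \<in> p"
    by (rule ultrafilter_on_mono[OF p]) auto
  then show "A \<inter> B \<in> usum S p q" using AB by (auto simp: in_usum_iff)
next
  fix A B assume AB: "A \<in> usum S p q \<and> A \<subseteq> B \<and> B \<subseteq> S"
  then have "{x \<in> S. lshift S x A \<in> q} \<in> p" by (simp add: in_usum_iff)
  moreover have "{x \<in> S. lshift S x A \<in> q} \<subseteq> {x \<in> S. lshift S x B \<in> q}"
  proof clarify
    fix x assume "lshift S x A \<in> q"
    then show "lshift S x B \<in> q"
      by (rule ultrafilter_on_mono[OF q]) (use AB in \<open>auto simp: lshift_def\<close>)
  qed
  ultimately have "{x \<in> S. lshift S x B \<in> q} \<in> p"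
    by (rule ultrafilter_on_mono[OF p]) simp
  then show "B \<in> usum S p q" using AB by (simp add: in_usum_iff)
next
  fix A assume A: "A \<subseteq> S"
  have "{x \<in> S. lshift S x (S - A) \<in> q} = S - {x \<in> S. lshift S x A \<in> q}"
    by (auto simp: lshift_Diff ultrafilter_on_Diff_iff[OF q lshift_subset])
  moreover have "{x \<in> S. lshift S x A \<in> q} \<in> p \<or> S - {x \<in> S. lshift S x A \<in> q} \<in> p"
    by (rule ultrafilter_on_cases[OF p]) auto
  ultimately show "A \<in> usum S p q \<or> S - A \<in> usum S p q"
    using A by (simp add: in_usum_iff)
qed

lemma usum_Oplus:
  assumes p: "p \<in> Oplus S" and q: "q \<in> Oplus S"
  shows "usum S p q \<in> Oplus S"
proof -
  have up: "ultrafilter_on S p" and uq: "ultrafilter_on S q"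
    using p q by (auto simp: Oplus_def)
  have "S \<inter> {0<..<\<epsilon>} \<in> usum S p q" if "\<epsilon> > 0" for \<epsilon>
  proof -
    have "S \<inter> {0<..<\<epsilon>} \<subseteq> {x \<in> S. lshift S x (S \<inter> {0<..<\<epsilon>}) \<in> q}"
    proof clarify
      fix x assume x: "x \<in> S" "x \<in> {0<..<\<epsilon>}"
      \<comment> \<open>After moving by \<open>x < \<epsilon>\<close> there is still room
        \<open>\<epsilon> - x > 0\<close>, and \<open>q\<close> lives arbitrarily close to
        zero.\<close>
      have "S \<inter> {0<..<\<epsilon> - x} \<in> q" using q x by (auto simp: Oplus_def)
      then show "lshift S x (S \<inter> {0<..<\<epsilon>}) \<in> q"
        by (rule ultrafilter_on_mono[OF uq])
          (use x in \<open>auto simp: lshift_def add_closed\<close>)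
    qed
    moreover have "S \<inter> {0<..<\<epsilon>} \<in> p" using p that by (auto simp: Oplus_def)
    ultimately have "{x \<in> S. lshift S x (S \<inter> {0<..<\<epsilon>}) \<in> q} \<in> p"
      using ultrafilter_on_mono[OF up] by auto
    then show ?thesis by (simp add: in_usum_iff)
  qed
  then show ?thesis using ultrafilter_on_usum[OF up uq] by (simp add: Oplus_def)
qed

text \<open>Both sides unfold to the same nested membership, because shifting by \<open>x\<close>
  and then by \<open>z\<close> is shifting by \<open>x + z\<close>.\<close>

lemma usum_assoc: "usum S (usum S p q) r = usum S p (usum S q r)"
proof (rule set_eqI)
  fix A
  have "lshift S x {z \<in> S. lshift S z A \<in> r} = {z \<in> S. lshift S z (lshift S x A) \<in> r}" if "x \<in> S" for x
  proof -
    have "lshift S x {z \<in> S. lshift S z A \<in> r} = {z \<in> S. lshift S (x + z) A \<in> r}"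
      using that by (auto simp: lshift_def[of S x] add_closed)
    also have "\<dots> = {z \<in> S. lshift S z (lshift S x A) \<in> r}"
      using that by (auto simp: lshift_lshift)
    finally show ?thesis .
  qed
  then show "A \<in> usum S (usum S p q) r \<longleftrightarrow> A \<in> usum S p (usum S q r)"
    by (auto simp: in_usum_iff lshift_subset cong: conj_cong)
qed

text \<open>For fixed \<open>q\<close>, whether \<open>A\<close> lies in \<open>usum S p q\<close>
  depends only on whether one fixed set lies in \<open>p\<close>. This makes right translations
  continuous.\<close>

lemma semigroup_Oplus:
  "compact_right_topological_semigroup (subtopology pointwise_topology (Oplus S)) (usum S)"
proof
  show "compact_space (subtopology pointwise_topology (Oplus S))"
    by (rule compact_space_subtopology)
      (rule closedin_compact_space[OF compact_space_pointwise_topology closedin_Oplus])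
  show "Hausdorff_space (subtopology pointwise_topology (Oplus S))"
    by (rule Hausdorff_space_subtopology[OF Hausdorff_space_pointwise_topology])
next
  fix q assume q: "q \<in> topspace (subtopology pointwise_topology (Oplus S))"
  have "continuous_map pointwise_topology (discrete_topology UNIV) (\<lambda>p. A \<in> usum S p q)" for A
    by (cases "A \<subseteq> S") (simp_all add: in_usum_iff continuous_map_membership)
  then have "continuous_map pointwise_topology pointwise_topology (\<lambda>p. usum S p q)"
    by (simp add: continuous_map_into_pointwise_topology)
  then show "continuous_map (subtopology pointwise_topology (Oplus S))
      (subtopology pointwise_topology (Oplus S)) (\<lambda>p. usum S p q)"
    using q usum_Oplus
    by (auto simp: continuous_map_in_subtopology intro: continuous_map_from_subtopology)
qed (use usum_Oplus usum_assoc in auto)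

interpretation Oplus: compact_right_topological_semigroup
    "subtopology pointwise_topology (Oplus S)" "usum S"
  by (rule semigroup_Oplus)

lemma closedin_subtopology_Oplus:
  "closedin (subtopology pointwise_topology (Oplus S)) C \<longleftrightarrow> closedin pointwise_topology C \<and> C \<subseteq> Oplus S"
  by (rule closedin_closed_subtopology[OF closedin_Oplus])

section \<open>The smallest ideal of the ultrafilters near zero\<close>

lemma Oplus_nonempty: "Oplus S \<noteq> {}"
proof -
  obtain p where "p \<in> Oplus S" "{S} \<subseteq> p"
    by (rule Oplus_extends_filter_base[of "{S}" S]) (use meets_initial_interval in auto)
  then show ?thesis by blast
qed

text \<open>The right-hand side describes a two-sided ideal by pure algebra; compactness enters only to
  show that it is nonempty.\<close>

lemma Kmin_iff:
  "z \<in> Kmin S \<longleftrightarrow> z \<in> Oplus S \<and> (\<forall>q \<in> Oplus S. \<exists>r \<in> Oplus S. z = usum S r (usum S q z))"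
    (is "_ \<longleftrightarrow> z \<in> Oplus S \<and> ?min z")
proof
  let ?I = "{z \<in> Oplus S. ?min z}"
  assume z: "z \<in> Kmin S"
  have "two_sided_ideal S ?I"
    unfolding two_sided_ideal_def
  proof (intro conjI ballI)
    have cl: "closedin (subtopology pointwise_topology (Oplus S)) (Oplus S)"
      by (simp add: closedin_subtopology_Oplus closedin_Oplus)
    have li: "Oplus.left_ideal (Oplus S)"
      using usum_Oplus by (simp add: Oplus.left_ideal_def)
    obtain L where L: "closedin (subtopology pointwise_topology (Oplus S)) L" "L \<noteq> {}"
      "Oplus.left_ideal L" "L \<subseteq> Oplus S"
      "\<forall>z \<in> L. \<forall>q \<in> topspace (subtopology pointwise_topology (Oplus S)).
         \<exists>r \<in> topspace (subtopology pointwise_topology (Oplus S)). z = usum S r (usum S q z)"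
      by (rule Oplus.closed_left_ideal_contains_minimal[OF cl Oplus_nonempty li])
    then obtain w where "w \<in> L" by blast
    then have "w \<in> ?I" using L(4) bspec[OF L(5) \<open>w \<in> L\<close>] by auto
    then show "?I \<noteq> {}" by blast
    show "?I \<subseteq> Oplus S" by blast
    fix c w assume c: "c \<in> Oplus S" and w: "w \<in> ?I"
    have wO: "w \<in> Oplus S" and min: "?min w" using w by simp_all
    have "?min (usum S c w)"
    proof
      fix q assume q: "q \<in> Oplus S"
      \<comment> \<open>The condition on \<open>w\<close> is applied to \<open>usum S q c\<close>
        rather than to \<open>q\<close>, so that associativity can split off
        \<open>usum S c w\<close> on the right.\<close>
      then obtain r where r: "r \<in> Oplus S" "w = usum S r (usum S (usum S q c) w)"
        using bspec[OF min usum_Oplus[OF q c]] by (elim bexE) (rule that)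
      have "usum S c w = usum S c (usum S r (usum S (usum S q c) w))"
        by (rule arg_cong[OF r(2)])
      also have "\<dots> = usum S (usum S c r) (usum S q (usum S c w))" by (simp add: usum_assoc)
      finally show "\<exists>r \<in> Oplus S. usum S c w = usum S r (usum S q (usum S c w))"
        using usum_Oplus[OF c r(1)] by blast
    qed
    then show "usum S c w \<in> ?I" using usum_Oplus[OF c wO] by simp
    have "?min (usum S w c)"
    proof
      fix q assume q: "q \<in> Oplus S"
      then obtain r where r: "r \<in> Oplus S" "w = usum S r (usum S q w)"
        using bspec[OF min q] by (elim bexE) (rule that)
      have "usum S w c = usum S (usum S r (usum S q w)) c"
        by (rule arg_cong[OF r(2), of "\<lambda>w. usum S w c"])
      also have "\<dots> = usum S r (usum S q (usum S w c))" by (simp add: usum_assoc)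
      finally show "\<exists>r \<in> Oplus S. usum S w c = usum S r (usum S q (usum S w c))"
        using r(1) by blast
    qed
    then show "usum S w c \<in> ?I" using usum_Oplus[OF wO c] by simp
  qed
  then have "z \<in> ?I" using z unfolding Kmin_def by blast
  then show "z \<in> Oplus S \<and> ?min z" by simp
next
  assume z: "z \<in> Oplus S \<and> ?min z"
  have "z \<in> I" if I: "two_sided_ideal S I" for I
  proof -
    obtain j where j: "j \<in> I" "j \<in> Oplus S" using I by (auto simp: two_sided_ideal_def)
    obtain r where r: "r \<in> Oplus S" "z = usum S r (usum S j z)"
      \<comment> \<open>Choosing \<open>q = j\<close> in the ideal puts \<open>usum S j z\<close>,
        and with it \<open>z\<close>, into \<open>I\<close>.\<close>
      using bspec[OF conjunct2[OF z] j(2)] by (elim bexE) (rule that)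
    have "usum S r (usum S j z) \<in> I"
      using I j(1) r(1) conjunct1[OF z] by (simp add: two_sided_ideal_def)
    then show ?thesis by (subst r(2))
  qed
  then show "z \<in> Kmin S" by (simp add: Kmin_def)
qed

text \<open>If syndeticity fails at scale \<open>\<epsilon>\<close>, some \<open>q\<close> near zero
  avoids all translates \<open>lshift S t R\<close> with \<open>t < \<epsilon>\<close>. Minimality
  writes \<open>z\<close> as \<open>usum S r (usum S q z)\<close>, and since \<open>r\<close> lives
  below \<open>\<epsilon>\<close>, the membership \<open>A \<in> z\<close> forces one such translate
  into \<open>q\<close>.\<close>

lemma syndetic_near_zero_return_times:
  assumes z: "z \<in> Kmin S" and A: "A \<in> z"
  shows "syndetic_near_zero S {s \<in> S. lshift S s A \<in> z}"
proof (rule ccontr)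
  define R where "R = {s \<in> S. lshift S s A \<in> z}"
  assume "\<not> syndetic_near_zero S {s \<in> S. lshift S s A \<in> z}"
  then obtain \<epsilon> where \<epsilon>: "\<epsilon> > 0"
    and not_cover: "\<And>F \<delta>. finite F \<Longrightarrow> F \<noteq> {} \<Longrightarrow> F \<subseteq> {0<..<\<epsilon>} \<inter> S \<Longrightarrow> \<delta> > 0
        \<Longrightarrow> \<not> S \<inter> {0<..<\<delta>} \<subseteq> (\<Union>t\<in>F. lshift S t R)"
    unfolding syndetic_near_zero_def R_def[symmetric] by metis
  \<comment> \<open>The empty \<open>F\<close> is allowed and contributes \<open>S\<close> itself;
    failure of syndeticity covers only nonempty \<open>F\<close>, whence the case split
    below.\<close>
  define G where "G = {S - (\<Union>t\<in>F. lshift S t R) | F. finite F \<and> F \<subseteq> {0<..<\<epsilon>} \<inter> S}"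
  obtain q where q: "q \<in> Oplus S" "G \<subseteq> q"
  proof (rule Oplus_extends_filter_base[of G S])
    fix B B' assume "B \<in> G" "B' \<in> G"
    then obtain F F' where F: "finite F" "F \<subseteq> {0<..<\<epsilon>} \<inter> S" "B = S - (\<Union>t\<in>F. lshift S t R)"
      "finite F'" "F' \<subseteq> {0<..<\<epsilon>} \<inter> S" "B' = S - (\<Union>t\<in>F'. lshift S t R)"
      unfolding G_def by auto
    have "B \<inter> B' = S - (\<Union>t\<in>F \<union> F'. lshift S t R)" unfolding F(3,6) by blast
    moreover have "finite (F \<union> F')" "F \<union> F' \<subseteq> {0<..<\<epsilon>} \<inter> S" using F by auto
    ultimately show "B \<inter> B' \<in> G" unfolding G_def by blast
  next
    fix B and \<delta> :: real assume "B \<in> G" "\<delta> > 0"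
    then obtain F where F: "finite F" "F \<subseteq> {0<..<\<epsilon>} \<inter> S" "B = S - (\<Union>t\<in>F. lshift S t R)"
      unfolding G_def by auto
    show "B \<inter> {0<..<\<delta>} \<noteq> {}"
    proof (cases "F = {}")
      case True
      then show ?thesis using F(3) meets_initial_interval[OF \<open>\<delta> > 0\<close>] by simp
    next
      case False
      then show ?thesis using not_cover[OF F(1) False F(2) \<open>\<delta> > 0\<close>] F(3) by blast
    qed
  next
    show "G \<noteq> {}" unfolding G_def by blast
  qed (auto simp: G_def)
  have uq: "ultrafilter_on S q" using q by (simp add: Oplus_def)
  have not_in: "lshift S t R \<notin> q" if "t \<in> {0<..<\<epsilon>} \<inter> S" for t
  proof -
    have "S - (\<Union>t\<in>{t}. lshift S t R) \<in> G" unfolding G_def using that by blast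
    then have "S - lshift S t R \<in> q" using q(2) by auto
    then show ?thesis using ultrafilter_on_Diff_iff[OF uq lshift_subset] by blast
  qed
  obtain r where r: "r \<in> Oplus S" "z = usum S r (usum S q z)"
    using z[unfolded Kmin_iff, THEN conjunct2, THEN bspec, OF q(1)] by (elim bexE) (rule that)
  have ur: "ultrafilter_on S r" and small: "S \<inter> {0<..<\<epsilon>} \<in> r"
    using r(1) \<epsilon> by (auto simp: Oplus_def)
  have "A \<in> usum S r (usum S q z)"
    using A by (subst r(2)[symmetric])
  then have "{x \<in> S. lshift S x A \<in> usum S q z} \<in> r"
    by (simp add: in_usum_iff)
  from ultrafilter_on_Int[OF ur this small]
  have "{x \<in> S. lshift S x A \<in> usum S q z} \<inter> (S \<inter> {0<..<\<epsilon>}) \<noteq> {}"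
    using ultrafilter_on_empty[OF ur] by metis
  then obtain x where x: "x \<in> S" "x \<in> {0<..<\<epsilon>}" "lshift S x A \<in> usum S q z" by blast
  have "{y \<in> S. lshift S y (lshift S x A) \<in> z} = lshift S x R"
    unfolding lshift_def[of S x R] using x(1) by (auto simp: R_def lshift_lshift add_closed)
  then have "lshift S x R \<in> q" using x(3) by (simp add: in_usum_iff)
  then show False using not_in x by blast
qed

subsection \<open>Central sets and dynamics\<close>

text \<open>The system is translation on all families of sets of reals with the pointwise topology,
  not only on ultrafilters: \<open>x\<close> is the principal ultrafilter at 0 and \<open>y\<close> is the ultrafilter
  \<open>p\<close> pushed forward to the reals.\<close>

lemma central_near_zero_imp_witness:
  assumes "central_near_zero S B"
  shows "\<exists>(X :: real set set topology) T x y U. central_witness S B X T x y U"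
proof -
  obtain p where p: "p \<in> Kmin S" "usum S p p = p" "B \<in> p"
    using assms by (auto simp: central_near_zero_def)
  have pO: "p \<in> Oplus S" using p(1) by (simp add: Kmin_iff)
  have up: "ultrafilter_on S p" using pO by (simp add: Oplus_def)
  \<comment> \<open>\<open>T s\<close> pushes a family forward along the translation
    \<open>z \<mapsto> s + z\<close> of the reals. Hence \<open>T s x\<close> is the principal
    ultrafilter at \<open>s\<close>, and the times at which it meets \<open>U\<close> are exactly
    the elements of \<open>B\<close>.\<close>
  define T :: "real \<Rightarrow> real set set \<Rightarrow> real set set" where "T s q = {A. {z. s + z \<in> A} \<in> q}" for s q
  define x :: "real set set" where "x = {A. 0 \<in> A}"
  define y where "y = {A. A \<inter> S \<in> p}"
  define U where "U = {q. B \<in> q}"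
  have Tx: "A \<in> T s x \<longleftrightarrow> s \<in> A" for A s
    by (simp add: T_def x_def)
  have Ty: "A \<in> T s y \<longleftrightarrow> lshift S s A \<in> p" for A s
  proof -
    have "{z. s + z \<in> A} \<inter> S = lshift S s A" by (auto simp: lshift_def)
    then show ?thesis by (simp add: T_def y_def)
  qed
  \<comment> \<open>One set \<open>C\<close> in \<open>p\<close> controls both orbits: it collects
    the \<open>s\<close> that belong to the same sets of a finite list as \<open>y\<close>
    prescribes. Proximality and recurrence thereby become statements about members of
    \<open>p\<close>.\<close>
  have near_y: "\<exists>C\<in>p. (\<forall>s\<in>C. T s x \<in> W) \<and> (\<forall>s\<in>S. lshift S s C \<in> p \<longrightarrow> T s y \<in> W)"
    if W: "openin pointwise_topology W" "y \<in> W" for W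
  proof -
    obtain F where F: "finite F" "{q. \<forall>A\<in>F. A \<in> q \<longleftrightarrow> A \<in> y} \<subseteq> W"
      by (rule openin_pointwise_topology_basis[OF W])
    define C where "C = {s \<in> S. \<forall>A\<in>F. s \<in> (if A \<in> y then A \<inter> S else S - (A \<inter> S))}"
    have "(if A \<in> y then A \<inter> S else S - (A \<inter> S)) \<in> p" for A
      using ultrafilter_on_Diff_iff[OF up, of "A \<inter> S"] by (simp add: y_def)
    then have C: "C \<in> p"
      unfolding C_def by (intro ultrafilter_on_finite_INT[OF up F(1)])
    have C_iff: "s \<in> C \<longleftrightarrow> s \<in> S \<and> (\<forall>A\<in>F. s \<in> A \<longleftrightarrow> A \<in> y)" for s
      by (auto simp: C_def)
    have "T s x \<in> W" if "s \<in> C" for s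
      by (rule subsetD[OF F(2)]) (use that in \<open>simp add: Tx C_iff\<close>)
    moreover have "T s y \<in> W" if s: "s \<in> S" "lshift S s C \<in> p" for s
    proof (rule subsetD[OF F(2)], rule CollectI, rule ballI)
      fix A assume A: "A \<in> F"
      show "A \<in> T s y \<longleftrightarrow> A \<in> y"
      proof (cases "A \<in> y")
        case True
        have "lshift S s C \<subseteq> lshift S s A"
          using A True by (auto simp: lshift_def C_iff)
        then have "lshift S s A \<in> p"
          by (rule ultrafilter_on_mono[OF up s(2) _ lshift_subset])
        with True show ?thesis by (simp add: Ty)
      next
        case False
        have "lshift S s C \<inter> lshift S s A = {}"
          using A False by (auto simp: lshift_def C_iff)
        then have "lshift S s A \<notin> p"
          using ultrafilter_on_Int[OF up s(2), of "lshift S s A"] ultrafilter_on_empty[OF up] by auto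
        with False show ?thesis by (simp add: Ty)
      qed
    qed
    ultimately show ?thesis using C by blast
  qed
  have "central_witness S B pointwise_topology T x y U"
    unfolding central_witness_def
  proof (intro conjI)
    show "dynamical_system S pointwise_topology T"
      unfolding dynamical_system_def
    proof (intro conjI ballI)
      fix s
      have "continuous_map pointwise_topology (discrete_topology UNIV) (\<lambda>q. A \<in> T s q)" for A
        by (simp add: T_def continuous_map_membership)
      then show "continuous_map pointwise_topology pointwise_topology (T s)"
        unfolding continuous_map_into_pointwise_topology by blast
      show "T s (T t z) = T (s + t) z" for t z
        by (simp add: T_def add.assoc)
    qed (rule compact_space_pointwise_topology Hausdorff_space_pointwise_topology)+
    have "y \<in> U"
      using p(3) ultrafilter_on_subset[OF up p(3)] by (simp add: U_def y_def Int_absorb2)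
    moreover have "openin pointwise_topology U"
      unfolding U_def by (rule clopen_membership)
    ultimately show "nbhd_of pointwise_topology {y} U"
      by (auto simp: nbhd_of_def)
    show "B = {s \<in> S. T s x \<in> U}"
      using ultrafilter_on_subset[OF up p(3)] by (auto simp: U_def Tx)
    show "proximal_near_zero S pointwise_topology T x y"
      unfolding proximal_near_zero_def
    proof (intro allI impI)
      fix N :: "(real set set \<times> real set set) set" and \<epsilon> :: real
      assume N: "nbhd_of (prod_topology pointwise_topology pointwise_topology)
          {(z, z) |z. z \<in> topspace pointwise_topology} N" and \<epsilon>: "\<epsilon> > 0"
      obtain V where V: "openin (prod_topology pointwise_topology pointwise_topology) V"
        "(y, y) \<in> V" "V \<subseteq> N"
        using N unfolding nbhd_of_def by auto
      obtain W1 W2 where W: "openin pointwise_topology W1" "openin pointwise_topology W2"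
        "y \<in> W1" "y \<in> W2" "W1 \<times> W2 \<subseteq> V"
        \<comment> \<open>It suffices to bring both orbits close to \<open>y\<close> at the same
          time, since then the pair is close to the diagonal point \<open>(y, y)\<close>.\<close>
        using V(1)[unfolded openin_prod_topology_alt, rule_format, OF V(2)] by blast
      obtain C where C: "C \<in> p" "\<forall>s\<in>C. T s x \<in> W1 \<inter> W2"
        "\<forall>s\<in>S. lshift S s C \<in> p \<longrightarrow> T s y \<in> W1 \<inter> W2"
        using near_y[of "W1 \<inter> W2"] W by blast
      \<comment> \<open>Idempotence: \<open>C \<in> p\<close> is read as
        \<open>C \<in> usum S p p\<close>.\<close>
      have "{s \<in> S. lshift S s C \<in> p} \<in> p"
        using C(1) p(2) in_usum_iff[of C S p p] by simp
      moreover have "S \<inter> {0<..<\<epsilon>} \<in> p" using pO \<epsilon> by (simp add: Oplus_def)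
      ultimately have "C \<inter> ({s \<in> S. lshift S s C \<in> p} \<inter> (S \<inter> {0<..<\<epsilon>})) \<in> p"
        by (rule ultrafilter_on_Int[OF up C(1) ultrafilter_on_Int[OF up]])
      then have "C \<inter> ({s \<in> S. lshift S s C \<in> p} \<inter> (S \<inter> {0<..<\<epsilon>})) \<noteq> {}"
        using ultrafilter_on_empty[OF up] by metis
      then obtain s where s: "s \<in> C" "s \<in> S" "lshift S s C \<in> p" "s \<in> {0<..<\<epsilon>}" by blast
      then have "(T s x, T s y) \<in> N" using C(2,3) W(5) V(3) by blast
      with s show "\<exists>s\<in>S \<inter> {0<..<\<epsilon>}. (T s x, T s y) \<in> N" by blast
    qed
    show "unif_recurrent_near_zero S pointwise_topology T y"
      unfolding unif_recurrent_near_zero_def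
    proof (intro allI impI)
      fix N assume "nbhd_of pointwise_topology {y} N"
      then obtain W where W: "openin pointwise_topology W" "y \<in> W" "W \<subseteq> N"
        unfolding nbhd_of_def by auto
      obtain C where C: "C \<in> p" "\<forall>s\<in>S. lshift S s C \<in> p \<longrightarrow> T s y \<in> W"
        using near_y[OF W(1,2)] by blast
      show "syndetic_near_zero S {s \<in> S. T s y \<in> N}"
        by (rule syndetic_near_zero_mono[OF syndetic_near_zero_return_times[OF p(1) C(1)]])
          (use C(2) W(3) in blast)
    qed
  qed (simp_all)
  then show ?thesis by blast
qed

section \<open>From proximality and uniform recurrence to a minimal idempotent\<close>

lemma witness_imp_central_near_zero:
  assumes "central_witness S B X T x y U"
  shows "central_near_zero S B"
proof -
  have compact: "compact_space X" and Hausdorff: "Hausdorff_space X"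
    and cont: "\<And>s. s \<in> S \<Longrightarrow> continuous_map X X (T s)"
    and act: "\<And>s t z. s \<in> S \<Longrightarrow> t \<in> S \<Longrightarrow> z \<in> topspace X \<Longrightarrow> T s (T t z) = T (s + t) z"
    and x: "x \<in> topspace X" and y: "y \<in> topspace X"
    and U: "nbhd_of X {y} U" and prox: "proximal_near_zero S X T x y"
    and recurrent: "unif_recurrent_near_zero S X T y" and B: "B = {s \<in> S. T s x \<in> U}"
    using assms by (simp_all add: central_witness_def dynamical_system_def)
  have Tclosed: "T s z \<in> topspace X" if "s \<in> S" "z \<in> topspace X" for s z
    using cont[OF that(1)] that(2) by (auto simp: continuous_map_def)
  define \<N> where "\<N> = {N. openin (prod_topology X X) N \<and> (\<forall>z \<in> topspace X. (z, z) \<in> N)}"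
  define D where "D N = {s \<in> S. (T s x, T s y) \<in> N}" for N
  define \<W> where "\<W> = {W. openin X W \<and> y \<in> W}"
  define R where "R W = {s \<in> S. T s y \<in> W}" for W
  \<comment> \<open>Membership in \<open>C\<close> encodes that \<open>T s x\<close> and
    \<open>T s y\<close> have the same limit along \<open>p\<close>.\<close>
  define C where "C = Oplus S \<inter> (\<Inter>N\<in>\<N>. {p. D N \<in> p})"

  have N_ne: "\<N> \<noteq> {}"
  proof -
    have "topspace (prod_topology X X) \<in> \<N>"
      unfolding \<N>_def using openin_topspace[of "prod_topology X X"] by simp
    then show ?thesis by blast
  qed
  have C_closed: "closedin (subtopology pointwise_topology (Oplus S)) C"
  proof -
    have "closedin pointwise_topology C"
      unfolding C_def by (intro closedin_Int closedin_Oplus closedin_INT N_ne clopen_membership(1))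
    then show ?thesis by (simp add: closedin_subtopology_Oplus C_def)
  qed
  have C_ne: "C \<noteq> {}"
  proof -
    obtain p where "p \<in> Oplus S" "D ` \<N> \<subseteq> p"
    proof (rule Oplus_extends_filter_base[of "D ` \<N>" S])
      fix A A' assume "A \<in> D ` \<N>" "A' \<in> D ` \<N>"
      then obtain N N' where N: "N \<in> \<N>" "A = D N" "N' \<in> \<N>" "A' = D N'" by blast
      then have "A \<inter> A' = D (N \<inter> N')" by (auto simp: D_def)
      moreover have "N \<inter> N' \<in> \<N>" using N by (auto simp: \<N>_def)
      ultimately show "A \<inter> A' \<in> D ` \<N>" by blast
    next
      fix A and \<epsilon> :: real assume "A \<in> D ` \<N>" "\<epsilon> > 0"
      then obtain N where N: "N \<in> \<N>" "A = D N" by blast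
      have "nbhd_of (prod_topology X X) {(z, z) |z. z \<in> topspace X} N"
        unfolding nbhd_of_def using N(1) by (intro exI[of _ N]) (auto simp: \<N>_def)
      then obtain s where "s \<in> S \<inter> {0<..<\<epsilon>}" "(T s x, T s y) \<in> N"
        using prox \<open>\<epsilon> > 0\<close> unfolding proximal_near_zero_def by blast
      then show "A \<inter> {0<..<\<epsilon>} \<noteq> {}" using N(2) by (auto simp: D_def)
    qed (use N_ne in \<open>auto simp: D_def\<close>)
    then have "p \<in> C" by (auto simp: C_def)
    then show ?thesis by blast
  qed
  have C_ideal: "Oplus.left_ideal C"
    unfolding Oplus.left_ideal_def
  proof (intro ballI)
    fix p q assume p: "p \<in> topspace (subtopology pointwise_topology (Oplus S))" and q: "q \<in> C"
    have pO: "p \<in> Oplus S" and qO: "q \<in> Oplus S" and qD: "\<And>N. N \<in> \<N> \<Longrightarrow> D N \<in> q"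
      using p q by (auto simp: C_def)
    have up: "ultrafilter_on S p" using pO by (simp add: Oplus_def)
    have "D N \<in> usum S p q" if N: "N \<in> \<N>" for N
    proof -
      have "lshift S s (D N) \<in> q" if s: "s \<in> S" for s
      proof -
        \<comment> \<open>The preimage of \<open>N\<close> under \<open>T s\<close> acting on both
          coordinates is again an open neighbourhood of the diagonal, and its times form the shift
          of \<open>D N\<close> by \<open>s\<close>.\<close>
        define M where "M = {z \<in> topspace (prod_topology X X). (T s (fst z), T s (snd z)) \<in> N}"
        have "continuous_map (prod_topology X X) (prod_topology X X) (\<lambda>z. (T s (fst z), T s (snd z)))"
          using continuous_map_compose[OF continuous_map_fst[of X X] cont[OF s]]
            continuous_map_compose[OF continuous_map_snd[of X X] cont[OF s]]
          by (simp add: continuous_map_pairwise o_def)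
        then have "openin (prod_topology X X) M"
          unfolding M_def using N by (intro openin_continuous_map_preimage) (auto simp: \<N>_def)
        then have "M \<in> \<N>"
          using N Tclosed[OF s] by (auto simp: \<N>_def M_def)
        moreover have "D M = lshift S s (D N)"
          using s x y by (auto simp: D_def M_def lshift_def act add_closed Tclosed)
        ultimately show ?thesis using qD by metis
      qed
      then have "{s \<in> S. lshift S s (D N) \<in> q} = S" by blast
      then show ?thesis
        using ultrafilter_on_space[OF up] by (auto simp: in_usum_iff D_def)
    qed
    then show "usum S p q \<in> C" using usum_Oplus[OF pO qO] by (simp add: C_def)
  qed
  obtain L where L: "closedin (subtopology pointwise_topology (Oplus S)) L" "L \<noteq> {}"
    "Oplus.left_ideal L" "L \<subseteq> C"
    "\<forall>z \<in> L. \<forall>q \<in> topspace (subtopology pointwise_topology (Oplus S)).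
       \<exists>r \<in> topspace (subtopology pointwise_topology (Oplus S)). z = usum S r (usum S q z)"
    by (rule Oplus.closed_left_ideal_contains_minimal[OF C_closed C_ne C_ideal])
  have LO: "L \<subseteq> Oplus S" and L_closed: "closedin pointwise_topology L"
    using L(1) by (simp_all add: closedin_subtopology_Oplus)
  have L_ideal: "usum S p q \<in> L" if "p \<in> Oplus S" "q \<in> L" for p q
    using L(3) that by (simp add: Oplus.left_ideal_def)

  have R_in_L: "\<exists>q\<in>L. R W \<in> q" if W: "W \<in> \<W>" for W
  proof -
    obtain r where r: "r \<in> L" using L(2) by blast
    have ur: "ultrafilter_on S r" and r0: "\<And>\<delta>. \<delta> > 0 \<Longrightarrow> S \<inter> {0<..<\<delta>} \<in> r"
      using r LO by (auto simp: Oplus_def)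
    have "nbhd_of X {y} W" using W by (auto simp: nbhd_of_def \<W>_def)
    then have synd: "syndetic_near_zero S (R W)"
      using recurrent by (simp add: unif_recurrent_near_zero_def R_def)
    \<comment> \<open>For each \<open>\<epsilon>\<close>, syndeticity covers an initial interval, a
      member of \<open>r\<close>, by finitely many shifts, so one shift by some
      \<open>t < \<epsilon>\<close> lies in \<open>r\<close>. An ultrafilter \<open>u\<close> near
      zero concentrated on such \<open>t\<close> puts \<open>R W\<close> into
      \<open>usum S u r\<close>.\<close>
    obtain u where u: "u \<in> Oplus S" "{{t \<in> S. lshift S t (R W) \<in> r}} \<subseteq> u"
    proof (rule Oplus_extends_filter_base[of "{{t \<in> S. lshift S t (R W) \<in> r}}" S])
      fix A and \<epsilon> :: real assume A: "A \<in> {{t \<in> S. lshift S t (R W) \<in> r}}" and "\<epsilon> > 0"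
      obtain F \<delta> where F: "finite F" "F \<subseteq> {0<..<\<epsilon>} \<inter> S" "\<delta> > 0"
        "S \<inter> {0<..<\<delta>} \<subseteq> (\<Union>t\<in>F. lshift S t (R W))"
        using synd \<open>\<epsilon> > 0\<close> unfolding syndetic_near_zero_def by meson
      have "(\<Union>t\<in>F. lshift S t (R W)) \<in> r"
        by (rule ultrafilter_on_mono[OF ur r0[OF F(3)] F(4)]) (use lshift_subset in blast)
      then obtain t where "t \<in> F" "lshift S t (R W) \<in> r"
        by (rule ultrafilter_on_finite_UN[OF ur F(1)])
      then show "A \<inter> {0<..<\<epsilon>} \<noteq> {}" using A F(2) by blast
    qed auto
    have "R W \<in> usum S u r" using u(2) by (auto simp: in_usum_iff R_def)
    then show ?thesis using L_ideal[OF u(1) r] by blast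
  qed

  \<comment> \<open>Membership in \<open>E\<close> encodes that \<open>T s y\<close> tends to
    \<open>y\<close> along \<open>q\<close>.\<close>
  define E where "E = L \<inter> (\<Inter>W\<in>\<W>. {q. R W \<in> q})"
  have topspace_W: "topspace X \<in> \<W>" using y by (simp add: \<W>_def)
  have E_closed: "closedin (subtopology pointwise_topology (Oplus S)) E"
  proof -
    have "\<W> \<noteq> {}" using topspace_W by blast
    then have "closedin pointwise_topology E"
      unfolding E_def by (intro closedin_Int L_closed closedin_INT clopen_membership(1))
    then show ?thesis using LO by (auto simp: closedin_subtopology_Oplus E_def)
  qed
  have E_ne: "E \<noteq> {}"
  proof -
    have "\<exists>q\<in>L. F \<subseteq> q" if F: "finite F" "F \<subseteq> R ` \<W>" for F
    proof -
      obtain \<V> where V: "\<V> \<subseteq> \<W>" "finite \<V>" "F = R ` \<V>"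
        using finite_subset_image[OF F] by (elim exE conjE) (rule that)
      \<comment> \<open>Inserting \<open>topspace X\<close> keeps the intersection an open set of
        the space even when \<open>\<V>\<close> is empty.\<close>
      have "openin X (\<Inter>(insert (topspace X) \<V>))"
        by (rule openin_Inter) (use V(1,2) in \<open>auto simp: \<W>_def\<close>)
      moreover have "y \<in> \<Inter>(insert (topspace X) \<V>)" using V(1) y by (auto simp: \<W>_def)
      ultimately have "\<Inter>(insert (topspace X) \<V>) \<in> \<W>" unfolding \<W>_def by blast
      then obtain q where q: "q \<in> L" "R (\<Inter>(insert (topspace X) \<V>)) \<in> q"
        using R_in_L by blast
      have uq: "ultrafilter_on S q" using q(1) LO by (auto simp: Oplus_def)
      have "R W \<in> q" if "W \<in> \<V>" for W
        by (rule ultrafilter_on_mono[OF uq q(2)]) (use that in \<open>auto simp: R_def\<close>)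
      then show ?thesis using q(1) V(3) by blast
    qed
    then obtain q where "q \<in> L" "R ` \<W> \<subseteq> q"
      by (rule closed_set_superset_compactness[OF L_closed])
    then have "q \<in> E" by (auto simp: E_def)
    then show ?thesis by blast
  qed
  have E_sub: "Oplus.subsemigroup E"
    unfolding Oplus.subsemigroup_def
  proof (intro ballI)
    fix p q assume p: "p \<in> E" and q: "q \<in> E"
    have up: "ultrafilter_on S p" using p LO by (auto simp: E_def Oplus_def)
    have "R W \<in> usum S p q" if W: "W \<in> \<W>" for W
    proof -
      have "R W \<subseteq> {s \<in> S. lshift S s (R W) \<in> q}"
      proof
        fix s assume "s \<in> R W"
        then have s: "s \<in> S" "T s y \<in> W" by (auto simp: R_def)
        \<comment> \<open>By continuity of \<open>T s\<close>, if \<open>T s y\<close> lies in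
          \<open>W\<close> then so does \<open>T s z\<close> for \<open>z\<close> near
          \<open>y\<close>; returns to \<open>V\<close> at time \<open>t\<close> are thus returns to
          \<open>W\<close> at time \<open>s + t\<close>.\<close>
        define V where "V = {z \<in> topspace X. T s z \<in> W}"
        have "openin X V"
          unfolding V_def using W by (intro openin_continuous_map_preimage[OF cont[OF s(1)]]) (simp add: \<W>_def)
        then have "V \<in> \<W>" using y s(2) by (simp add: \<W>_def V_def)
        then have "R V \<in> q" using q by (simp add: E_def)
        moreover have "R V = lshift S s (R W)"
          using s(1) y by (auto simp: R_def V_def lshift_def act add_closed Tclosed)
        ultimately show "s \<in> {s \<in> S. lshift S s (R W) \<in> q}" using s(1) by simp
      qed
      moreover have "R W \<in> p" using p W by (simp add: E_def)
      ultimately have "{s \<in> S. lshift S s (R W) \<in> q} \<in> p"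
        using ultrafilter_on_mono[OF up, of "R W" "{s \<in> S. lshift S s (R W) \<in> q}"] by simp
      then show ?thesis by (auto simp: in_usum_iff R_def)
    qed
    moreover have "usum S p q \<in> L" using p q LO by (intro L_ideal) (auto simp: E_def)
    ultimately show "usum S p q \<in> E" by (simp add: E_def)
  qed
  obtain e where e: "e \<in> E" "usum S e e = e"
    by (rule Oplus.closed_subsemigroup_contains_idempotent[OF E_closed E_ne E_sub])
  have eL: "e \<in> L" and eW: "\<And>W. W \<in> \<W> \<Longrightarrow> R W \<in> e" using e(1) by (auto simp: E_def)
  have eN: "\<And>N. N \<in> \<N> \<Longrightarrow> D N \<in> e" using eL L(4) by (auto simp: C_def)
  have eK: "e \<in> Kmin S"
    unfolding Kmin_iff using eL LO bspec[OF L(5) eL] by auto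
  have ue: "ultrafilter_on S e" using eL LO by (auto simp: Oplus_def)

  obtain U' where U': "openin X U'" "y \<in> U'" "U' \<subseteq> U" using U by (auto simp: nbhd_of_def)
  have base: "neighbourhood_base_of (closedin X) X"
    using compact_Hausdorff_imp_regular_space[OF compact Hausdorff]
    by (simp add: neighbourhood_base_of_closedin)
  \<comment> \<open>Regularity places a closed \<open>K\<close> between \<open>V\<close> and
    \<open>U'\<close>; its open complement is what makes \<open>N\<close> below an open
    neighbourhood of the diagonal.\<close>
  obtain V K where V: "openin X V" "closedin X K" "y \<in> V" "V \<subseteq> K" "K \<subseteq> U'"
    using base[unfolded neighbourhood_base_of, rule_format, OF conjI[OF U'(1,2)]] by blast
  \<comment> \<open>For \<open>(a, b)\<close> in this neighbourhood of the diagonal, \<open>b \<in> V\<close> forces \<open>a \<in> U'\<close>.\<close>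
  define N where "N = topspace X \<times> (topspace X - K) \<union> U' \<times> topspace X"
  have "openin (prod_topology X X) N"
    unfolding N_def using U'(1) V(2)
    by (intro openin_Un openin_prod_Times_iff[THEN iffD2] disjI2 conjI openin_topspace openin_diff)
  then have "N \<in> \<N>" using V(5) by (auto simp: \<N>_def N_def)
  then have "D N \<inter> R V \<in> e"
    using V by (intro ultrafilter_on_Int[OF ue] eN eW) (auto simp: \<W>_def)
  then have "B \<in> e"
    by (rule ultrafilter_on_mono[OF ue]) (use V(4) U'(3) in \<open>auto simp: B D_def R_def N_def\<close>)
  then show ?thesis
    unfolding central_near_zero_def using eK e(2) by blast
qed

end

text \<open>Types cannot be quantified inside a formula. The equivalence is therefore stated over
  the carrier type of the constructed system, and the second conjunct gives the converse for systems
  over an arbitrary type.\<close>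

theorem theorem2p11:
  fixes S B :: "real set"
  assumes "dense_subsemigroup S" and "B \<subseteq> S"
  shows "(central_near_zero S B \<longleftrightarrow>
            (\<exists>(X :: real set set topology) T x y U. central_witness S B X T x y U))
       \<and> ((\<exists>(X :: 'a topology) T x y U. central_witness S B X T x y U) \<longrightarrow> central_near_zero S B)"
  by (auto intro: central_near_zero_imp_witness[OF assms(1)] witness_imp_central_near_zero[OF assms(1)])

end
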